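(* Let $(M,\varphi,\xi,\eta,g)$ be a $(2n+1)$-dimensional almost contact B-metric manifold in the class $\mathcal{F}_1\oplus\mathcal{F}_4\oplus\mathcal{F}_5\oplus\mathcal{F}_{11}$, and let $D$ be a natural connection on $M$ whose torsion $T$ is expressed by the metric tensors and the structural 1-forms (in the sense specified in the context). Then there exist $\alpha_1,\alpha_2,\alpha_3,\alpha_4\in\mathbb{R}$ such that for all vector fields $x,y,z$ $$T(x,y,z)=(\pi_3+\pi_5)(x,y,z,q)+\frac{1}{2n}(\pi_2+\pi_4)(x,y,z,a^* )+\frac{1}{2n}\pi_5(x,y,z,a)-\pi_5(x,y,z,\hat a),$$ where $q=\alpha_1\varphi^2a^*-\alpha_2\varphi^2a-\alpha_3\varphi\hat a+\alpha_4\hat a$.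
   Context: An almost contact B-metric manifold $(M,\varphi,\xi,\eta,g)$ is a $(2n+1)$-dimensional smooth manifold with an endomorphism $\varphi$ of the tangent bundle, a vector field $\xi$, a 1-form $\eta$ and a pseudo-Riemannian metric $g$ of signature $(n,n+1)$ such that $\varphi\xi=0$, $\varphi^2=-\mathrm{Id}+\eta\otimes\xi$, $\eta\circ\varphi=0$, $\eta(\xi)=1$ and $g(x,y)=-g(\varphi x,\varphi y)+\eta(x)\eta(y)$. Below $x,y,z,w$ are arbitrary vector fields. The associated metric is $\tilde g(x,y)=g(x,\varphi y)+\eta(x)\eta(y)$. Let $\nabla$ be the Levi-Civita connection of $g$ and $F(x,y,z)=g((\nabla_x\varphi)y,z)$. Define the 1-forms $\theta(z)=g^{ij}F(e_i,e_j,z)$, $\theta^*(z)=g^{ij}F(e_i,\varphi e_j,z)$, $\omega(z)=F(\xi,\xi,z)$, where $\{e_i;\xi\}$ $(i=1,\dots,2n)$ is a basis of $T_pM$ with $e_i\in\ker\eta$ and $g^{ij}$ are the components of the inverse matrix of $g$. The vector fields $a,a^*,\hat a$ are defined by $\theta=g(\cdot,a)$, $\theta^*=g(\cdot,a^* )$, $\omega=g(\cdot,\hat a)$. $M$ belongs to the class $\mathcal{F}_1\oplus\mathcal{F}_4\oplus\mathcal{F}_5\oplus\mathcal{F}_{11}$ if $$F(x,y,z)=-\tfrac{1}{2n}\bigl\{g(\varphi x,\varphi y)\theta(z)+g(x,\varphi y)\theta^*(z)-2n\,\eta(x)\eta(y)\omega(z)+g(\varphi x,\varphi z)\theta(y)+g(x,\varphi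 z)\theta^*(y)-2n\,\eta(x)\eta(z)\omega(y)\bigr\}.$$ A linear connection $D$ is natural if $D\varphi=D\xi=D\eta=Dg=0$. Its torsion is $T(x,y)=D_xy-D_yx-[x,y]$, and $T(x,y,z)=g(T(x,y),z)$. The torsion $T$ is expressed by the metric tensors and the structural 1-forms if $$T(x,y,z)=g(\varphi y,\varphi z)\vartheta_1(x)+g(y,\varphi z)\vartheta_2(x)+\eta(y)\eta(z)\vartheta_3(x)-g(\varphi x,\varphi z)\vartheta_1(y)-g(x,\varphi z)\vartheta_2(y)-\eta(x)\eta(z)\vartheta_3(y),$$ where, for some $\lambda_1,\dots,\lambda_{18}\in\mathbb{R}$ and for $k=1,2,3$, with $m=6(k-1)$, $$\vartheta_k(x)=\lambda_{m+1}\theta(\varphi^2x)+\lambda_{m+2}\theta^*(\varphi^2x)+\lambda_{m+3}\theta(\xi)\eta(x)+\lambda_{m+4}\theta^*(\xi)\eta(x)+\lambda_{m+5}\omega(x)+\lambda_{m+6}\omega(\varphi x).$$ For a tensor $A$ write $\{A(x,y)\}_{[x\leftrightarrow y]}=A(x,y)-A(y,x)$. Define $\pi_2(x,y)z=\{g(y,\varphi z)\varphi x\}_{[x\leftrightarrow y]}$, $\pi_3(x,y)z=-\{g(y,z)\varphi x+g(y,\varphi z)x\}_{[x\leftrightarrow y]}$, $\pi_4(x,y)z=\{\eta(y)\eta(z)x+g(y,z)\eta(x)\xi\}_{[x\leftrightarrow y]}$, $\pi_5(x,y)z=\{\eta(y)\eta(z)\varphi x+g(y,\varphi z)\eta(x)\xi\}_{[x\leftrightarrow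 y]}$, and $\pi_i(x,y,z,w)=g(\pi_i(x,y)z,w)$. *)

theory Defs
  imports "HOL-Analysis.Analysis"
begin

section \<open>Smooth manifolds and vector fields\<close>

text \<open>\<open>Ck_on k f S\<close> is meant for open \<open>S\<close>: all iterated directional derivatives of \<open>f\<close> up to
  order \<open>k\<close> exist and are continuous on \<open>S\<close>.\<close>

primrec Ck_on :: "nat \<Rightarrow> ('a::euclidean_space \<Rightarrow> 'b::real_normed_vector) \<Rightarrow> 'a set \<Rightarrow> bool" where
  "Ck_on 0 f S \<longleftrightarrow> continuous_on S f"
| "Ck_on (Suc k) f S \<longleftrightarrow> (\<forall>x\<in>S. f differentiable (at x)) \<and>
     (\<forall>v. Ck_on k (\<lambda>x. frechet_derivative f (at x) v) S)"

definition smooth_on :: "('a::euclidean_space \<Rightarrow> 'b::real_normed_vector) \<Rightarrow> 'a set \<Rightarrow> bool" where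
  "smooth_on f S \<longleftrightarrow> (\<forall>k. Ck_on k f S)"

text \<open>A chart is a domain together with a coordinate map. The points of the manifold are the
  elements of the type \<open>'m\<close>; the model space is \<open>'e\<close>, so the dimension is \<open>DIM('e)\<close>.\<close>

type_synonym ('m, 'e) chart = "'m set \<times> ('m \<Rightarrow> 'e)"

definition chart_inv :: "('m, 'e) chart \<Rightarrow> 'e \<Rightarrow> 'm" where
  "chart_inv c = inv_into (fst c) (snd c)"

definition smooth_atlas ::
    "('m::{t2_space,second_countable_topology}, 'e::euclidean_space) chart set \<Rightarrow> bool" where
  "smooth_atlas A \<longleftrightarrow>
     (\<Union>c\<in>A. fst c) = UNIV \<and>
     (\<forall>c\<in>A. open (fst c) \<and> open (snd c ` fst c) \<and>
        homeomorphism (fst c) (snd c ` fst c) (snd c) (chart_inv c)) \<and>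
     (\<forall>c\<in>A. \<forall>c'\<in>A. smooth_on (snd c' \<circ> chart_inv c) (snd c ` (fst c \<inter> fst c')))"

definition smooth_fun :: "('m, 'e::euclidean_space) chart set \<Rightarrow> ('m \<Rightarrow> real) \<Rightarrow> bool" where
  "smooth_fun A f \<longleftrightarrow> (\<forall>c\<in>A. smooth_on (f \<circ> chart_inv c) (snd c ` fst c))"

text \<open>At every point \<open>p\<close> one chart around \<open>p\<close> is singled out, and the tangent space at \<open>p\<close> is
  identified with \<open>'e\<close> by means of that chart: a tangent vector at \<open>p\<close> is given by its components
  in \<open>chart_at A p\<close>. Its components in another chart are obtained from the derivative of the
  coordinate change. As \<open>chart_at A p\<close> depends on \<open>p\<close> in an arbitrary way, smoothness of a vector
  field is tested on its components in the charts, not on the map \<open>'m \<Rightarrow> 'e\<close> itself.\<close>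

definition chart_at :: "('m, 'e) chart set \<Rightarrow> 'm \<Rightarrow> ('m, 'e) chart" where
  "chart_at A p = (SOME c. c \<in> A \<and> p \<in> fst c)"

definition components ::
    "('m, 'e::euclidean_space) chart set \<Rightarrow> ('m, 'e) chart \<Rightarrow> 'm \<Rightarrow> 'e \<Rightarrow> 'e" where
  "components A c p v =
     frechet_derivative (snd c \<circ> chart_inv (chart_at A p)) (at (snd (chart_at A p) p)) v"

definition local_rep ::
    "('m, 'e::euclidean_space) chart set \<Rightarrow> ('m, 'e) chart \<Rightarrow> ('m \<Rightarrow> 'e) \<Rightarrow> 'e \<Rightarrow> 'e" where
  "local_rep A c X = (\<lambda>x. components A c (chart_inv c x) (X (chart_inv c x)))"

definition vector_field :: "('m, 'e::euclidean_space) chart set \<Rightarrow> ('m \<Rightarrow> 'e) \<Rightarrow> bool" where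
  "vector_field A X \<longleftrightarrow> (\<forall>c\<in>A. smooth_on (local_rep A c X) (snd c ` fst c))"

text \<open>The derivative \<open>X f\<close> of a function \<open>f\<close> along \<open>X\<close>.\<close>

definition dir_deriv ::
    "('m, 'e::euclidean_space) chart set \<Rightarrow> ('m \<Rightarrow> 'e) \<Rightarrow> ('m \<Rightarrow> real) \<Rightarrow> 'm \<Rightarrow> real" where
  "dir_deriv A X f p =
     frechet_derivative (f \<circ> chart_inv (chart_at A p)) (at (snd (chart_at A p) p)) (X p)"

text \<open>The coordinate expression \<open>X\<^sup>i \<partial>\<^sub>i Y\<^sup>j - Y\<^sup>i \<partial>\<^sub>i X\<^sup>j\<close> of the Lie bracket, in the chart
  \<open>chart_at A p\<close>.\<close>

definition lie_bracket ::
    "('m, 'e::euclidean_space) chart set \<Rightarrow> ('m \<Rightarrow> 'e) \<Rightarrow> ('m \<Rightarrow> 'e) \<Rightarrow> 'm \<Rightarrow> 'e" where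
  "lie_bracket A X Y p = (let c = chart_at A p in
     frechet_derivative (local_rep A c Y) (at (snd c p)) (X p) -
     frechet_derivative (local_rep A c X) (at (snd c p)) (Y p))"


section \<open>Almost contact B-metric manifolds\<close>

record ('m, 'e) acb =
  atlas :: "('m, 'e) chart set"
  phi :: "'m \<Rightarrow> 'e \<Rightarrow> 'e"
  xi :: "'m \<Rightarrow> 'e"
  eta :: "'m \<Rightarrow> 'e \<Rightarrow> real"
  met :: "'m \<Rightarrow> 'e \<Rightarrow> 'e \<Rightarrow> real"

text \<open>Signature \<open>(r, s)\<close>: \<open>r\<close> negative and \<open>s\<close> positive directions. This is the order in which a
  B-metric has signature \<open>(n, n + 1)\<close>: it is neutral on \<open>ker \<eta>\<close>, and \<open>g(\<xi>, \<xi>) = 1\<close>.\<close>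

definition has_signature :: "('e::euclidean_space \<Rightarrow> 'e \<Rightarrow> real) \<Rightarrow> nat \<Rightarrow> nat \<Rightarrow> bool" where
  "has_signature B r s \<longleftrightarrow>
     (\<exists>N P. finite N \<and> finite P \<and> N \<inter> P = {} \<and> card N = r \<and> card P = s \<and>
        independent (N \<union> P) \<and> span (N \<union> P) = UNIV \<and>
        (\<forall>u\<in>N \<union> P. \<forall>v\<in>N \<union> P. u \<noteq> v \<longrightarrow> B u v = 0) \<and>
        (\<forall>u\<in>N. B u u = - 1) \<and> (\<forall>u\<in>P. B u u = 1))"

definition almost_contact_B_metric ::
    "nat \<Rightarrow> ('m::{t2_space,second_countable_topology}, 'e::euclidean_space) acb \<Rightarrow> bool" where
  "almost_contact_B_metric n M \<longleftrightarrow>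
     smooth_atlas (atlas M) \<and> DIM('e) = 2 * n + 1 \<and>
     (\<forall>p. linear (phi M p)) \<and>
     (\<forall>X. vector_field (atlas M) X \<longrightarrow> vector_field (atlas M) (\<lambda>p. phi M p (X p))) \<and>
     vector_field (atlas M) (xi M) \<and>
     (\<forall>p. linear (eta M p)) \<and>
     (\<forall>X. vector_field (atlas M) X \<longrightarrow> smooth_fun (atlas M) (\<lambda>p. eta M p (X p))) \<and>
     (\<forall>p. bilinear (met M p)) \<and>
     (\<forall>X Y. vector_field (atlas M) X \<longrightarrow> vector_field (atlas M) Y \<longrightarrow>
        smooth_fun (atlas M) (\<lambda>p. met M p (X p) (Y p))) \<and>
     (\<forall>p x y. met M p x y = met M p y x) \<and>
     (\<forall>p. has_signature (met M p) n (n + 1)) \<and>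
     (\<forall>p. phi M p (xi M p) = 0) \<and>
     (\<forall>p x. phi M p (phi M p x) = - x + eta M p x *\<^sub>R xi M p) \<and>
     (\<forall>p x. eta M p (phi M p x) = 0) \<and>
     (\<forall>p. eta M p (xi M p) = 1) \<and>
     (\<forall>p x y. met M p x y = - met M p (phi M p x) (phi M p y) + eta M p x * eta M p y)"


section \<open>Linear connections\<close>

text \<open>\<open>D X Y\<close> is \<open>D\<^sub>X Y\<close>; only its values on (smooth) vector fields matter.\<close>

definition linear_connection ::
    "('m, 'e::euclidean_space) chart set \<Rightarrow> (('m \<Rightarrow> 'e) \<Rightarrow> ('m \<Rightarrow> 'e) \<Rightarrow> 'm \<Rightarrow> 'e) \<Rightarrow> bool" where
  "linear_connection A D \<longleftrightarrow>
     (\<forall>X Y. vector_field A X \<longrightarrow> vector_field A Y \<longrightarrow> vector_field A (D X Y)) \<and>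
     (\<forall>X X' Y p. vector_field A X \<longrightarrow> vector_field A X' \<longrightarrow> vector_field A Y \<longrightarrow>
        D (\<lambda>q. X q + X' q) Y p = D X Y p + D X' Y p) \<and>
     (\<forall>f X Y p. smooth_fun A f \<longrightarrow> vector_field A X \<longrightarrow> vector_field A Y \<longrightarrow>
        D (\<lambda>q. f q *\<^sub>R X q) Y p = f p *\<^sub>R D X Y p) \<and>
     (\<forall>X Y Y' p. vector_field A X \<longrightarrow> vector_field A Y \<longrightarrow> vector_field A Y' \<longrightarrow>
        D X (\<lambda>q. Y q + Y' q) p = D X Y p + D X Y' p) \<and>
     (\<forall>f X Y p. smooth_fun A f \<longrightarrow> vector_field A X \<longrightarrow> vector_field A Y \<longrightarrow>
        D X (\<lambda>q. f q *\<^sub>R Y q) p = dir_deriv A X f p *\<^sub>R Y p + f p *\<^sub>R D X Y p)"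

definition torsion ::
    "('m, 'e::euclidean_space) chart set \<Rightarrow> (('m \<Rightarrow> 'e) \<Rightarrow> ('m \<Rightarrow> 'e) \<Rightarrow> 'm \<Rightarrow> 'e) \<Rightarrow>
     ('m \<Rightarrow> 'e) \<Rightarrow> ('m \<Rightarrow> 'e) \<Rightarrow> 'm \<Rightarrow> 'e" where
  "torsion A D X Y p = D X Y p - D Y X p - lie_bracket A X Y p"

text \<open>\<open>D g = 0\<close>.\<close>

definition metric_connection ::
    "('m, 'e::euclidean_space) acb \<Rightarrow> (('m \<Rightarrow> 'e) \<Rightarrow> ('m \<Rightarrow> 'e) \<Rightarrow> 'm \<Rightarrow> 'e) \<Rightarrow> bool" where
  "metric_connection M D \<longleftrightarrow>
     (\<forall>X Y Z p. vector_field (atlas M) X \<longrightarrow> vector_field (atlas M) Y \<longrightarrow> vector_field (atlas M) Z \<longrightarrow>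
        dir_deriv (atlas M) X (\<lambda>q. met M q (Y q) (Z q)) p =
          met M p (D X Y p) (Z p) + met M p (Y p) (D X Z p))"

definition levi_civita ::
    "('m, 'e::euclidean_space) acb \<Rightarrow> (('m \<Rightarrow> 'e) \<Rightarrow> ('m \<Rightarrow> 'e) \<Rightarrow> 'm \<Rightarrow> 'e) \<Rightarrow> bool" where
  "levi_civita M D \<longleftrightarrow> linear_connection (atlas M) D \<and> metric_connection M D \<and>
     (\<forall>X Y p. vector_field (atlas M) X \<longrightarrow> vector_field (atlas M) Y \<longrightarrow> torsion (atlas M) D X Y p = 0)"

text \<open>\<open>D \<phi> = D \<xi> = D \<eta> = D g = 0\<close>.\<close>

definition natural_connection ::
    "('m, 'e::euclidean_space) acb \<Rightarrow> (('m \<Rightarrow> 'e) \<Rightarrow> ('m \<Rightarrow> 'e) \<Rightarrow> 'm \<Rightarrow> 'e) \<Rightarrow> bool" where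
  "natural_connection M D \<longleftrightarrow> linear_connection (atlas M) D \<and>
     (\<forall>X Y p. vector_field (atlas M) X \<longrightarrow> vector_field (atlas M) Y \<longrightarrow>
        D X (\<lambda>q. phi M q (Y q)) p - phi M p (D X Y p) = 0) \<and>
     (\<forall>X p. vector_field (atlas M) X \<longrightarrow> D X (xi M) p = 0) \<and>
     (\<forall>X Y p. vector_field (atlas M) X \<longrightarrow> vector_field (atlas M) Y \<longrightarrow>
        dir_deriv (atlas M) X (\<lambda>q. eta M q (Y q)) p - eta M p (D X Y p) = 0) \<and>
     metric_connection M D"


section \<open>The tensor \<open>F\<close> and the structural 1-forms\<close>

text \<open>In this section \<open>D\<close> stands for the Levi-Civita connection.\<close>

definition F_tensor ::
    "('m, 'e::euclidean_space) acb \<Rightarrow> (('m \<Rightarrow> 'e) \<Rightarrow> ('m \<Rightarrow> 'e) \<Rightarrow> 'm \<Rightarrow> 'e) \<Rightarrow>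
     ('m \<Rightarrow> 'e) \<Rightarrow> ('m \<Rightarrow> 'e) \<Rightarrow> ('m \<Rightarrow> 'e) \<Rightarrow> 'm \<Rightarrow> real" where
  "F_tensor M D X Y Z p =
     met M p (D X (\<lambda>q. phi M q (Y q)) p - phi M p (D X Y p)) (Z p)"

text \<open>The value of \<open>F\<close> on tangent vectors at \<open>p\<close>, computed from vector fields through them; since
  \<open>F\<close> is tensorial the choice of these is immaterial.\<close>

definition field_through :: "('m, 'e::euclidean_space) chart set \<Rightarrow> 'm \<Rightarrow> 'e \<Rightarrow> 'm \<Rightarrow> 'e" where
  "field_through A p u = (SOME X. vector_field A X \<and> X p = u)"

definition F_at ::
    "('m, 'e::euclidean_space) acb \<Rightarrow> (('m \<Rightarrow> 'e) \<Rightarrow> ('m \<Rightarrow> 'e) \<Rightarrow> 'm \<Rightarrow> 'e) \<Rightarrow>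
     'm \<Rightarrow> 'e \<Rightarrow> 'e \<Rightarrow> 'e \<Rightarrow> real" where
  "F_at M D p u v w = F_tensor M D
     (field_through (atlas M) p u) (field_through (atlas M) p v) (field_through (atlas M) p w) p"

text \<open>\<open>e 1, \<dots>, e (2 n)\<close> are the \<open>e\<^sub>i\<close>, and \<open>e 0\<close> is \<open>\<xi>\<close>.\<close>

definition adapted_basis ::
    "nat \<Rightarrow> ('m, 'e::euclidean_space) acb \<Rightarrow> 'm \<Rightarrow> (nat \<Rightarrow> 'e) \<Rightarrow> bool" where
  "adapted_basis n M p e \<longleftrightarrow>
     e 0 = xi M p \<and> (\<forall>i\<in>{1..2*n}. eta M p (e i) = 0) \<and>
     inj_on e {0..2*n} \<and> independent (e ` {0..2*n}) \<and> span (e ` {0..2*n}) = UNIV"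

definition inverse_gram ::
    "nat \<Rightarrow> ('m, 'e::euclidean_space) acb \<Rightarrow> 'm \<Rightarrow> (nat \<Rightarrow> 'e) \<Rightarrow> nat \<Rightarrow> nat \<Rightarrow> real" where
  "inverse_gram n M p e = (SOME h. \<forall>i\<in>{0..2*n}. \<forall>j\<in>{0..2*n}.
     (\<Sum>k=0..2*n. h i k * met M p (e k) (e j)) = (if i = j then 1 else 0))"

text \<open>The contraction \<open>g\<^sup>i\<^sup>j B(e\<^sub>i, e\<^sub>j)\<close> over \<open>i, j = 1, \<dots>, 2 n\<close>; for bilinear \<open>B\<close> it does not depend
  on the choice of the adapted basis.\<close>

definition contraction ::
    "nat \<Rightarrow> ('m, 'e::euclidean_space) acb \<Rightarrow> 'm \<Rightarrow> ('e \<Rightarrow> 'e \<Rightarrow> real) \<Rightarrow> real" where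
  "contraction n M p B =
     (let e = (SOME e. adapted_basis n M p e); h = inverse_gram n M p e in
        \<Sum>i=1..2*n. \<Sum>j=1..2*n. h i j * B (e i) (e j))"

definition theta ::
    "nat \<Rightarrow> ('m, 'e::euclidean_space) acb \<Rightarrow> (('m \<Rightarrow> 'e) \<Rightarrow> ('m \<Rightarrow> 'e) \<Rightarrow> 'm \<Rightarrow> 'e) \<Rightarrow>
     'm \<Rightarrow> 'e \<Rightarrow> real" where
  "theta n M D p z = contraction n M p (\<lambda>u v. F_at M D p u v z)"

definition theta_star ::
    "nat \<Rightarrow> ('m, 'e::euclidean_space) acb \<Rightarrow> (('m \<Rightarrow> 'e) \<Rightarrow> ('m \<Rightarrow> 'e) \<Rightarrow> 'm \<Rightarrow> 'e) \<Rightarrow>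
     'm \<Rightarrow> 'e \<Rightarrow> real" where
  "theta_star n M D p z = contraction n M p (\<lambda>u v. F_at M D p u (phi M p v) z)"

definition omega ::
    "('m, 'e::euclidean_space) acb \<Rightarrow> (('m \<Rightarrow> 'e) \<Rightarrow> ('m \<Rightarrow> 'e) \<Rightarrow> 'm \<Rightarrow> 'e) \<Rightarrow>
     'm \<Rightarrow> 'e \<Rightarrow> real" where
  "omega M D p z = F_at M D p (xi M p) (xi M p) z"

text \<open>The vector field metrically dual to a 1-form.\<close>

definition metric_dual ::
    "('m, 'e::euclidean_space) acb \<Rightarrow> ('m \<Rightarrow> 'e \<Rightarrow> real) \<Rightarrow> 'm \<Rightarrow> 'e" where
  "metric_dual M \<alpha> p = (THE v. \<forall>u. \<alpha> p u = met M p u v)"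

definition class_F1_F4_F5_F11 ::
    "nat \<Rightarrow> ('m, 'e::euclidean_space) acb \<Rightarrow> (('m \<Rightarrow> 'e) \<Rightarrow> ('m \<Rightarrow> 'e) \<Rightarrow> 'm \<Rightarrow> 'e) \<Rightarrow> bool" where
  "class_F1_F4_F5_F11 n M D \<longleftrightarrow>
     (\<forall>X Y Z p. vector_field (atlas M) X \<longrightarrow> vector_field (atlas M) Y \<longrightarrow> vector_field (atlas M) Z \<longrightarrow>
        (let x = X p; y = Y p; z = Z p; f = phi M p; g = met M p; \<eta> = eta M p;
             \<theta> = theta n M D p; \<theta>s = theta_star n M D p; \<omega> = omega M D p
         in F_tensor M D X Y Z p = - 1 / (2 * real n) *
           (g (f x) (f y) * \<theta> z + g x (f y) * \<theta>s z - 2 * real n * \<eta> x * \<eta> y * \<omega> z +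
            g (f x) (f z) * \<theta> y + g x (f z) * \<theta>s y - 2 * real n * \<eta> x * \<eta> z * \<omega> y)))"


section \<open>Torsions expressed by the structural 1-forms\<close>

definition vartheta ::
    "nat \<Rightarrow> ('m, 'e::euclidean_space) acb \<Rightarrow> (('m \<Rightarrow> 'e) \<Rightarrow> ('m \<Rightarrow> 'e) \<Rightarrow> 'm \<Rightarrow> 'e) \<Rightarrow>
     (nat \<Rightarrow> real) \<Rightarrow> nat \<Rightarrow> 'm \<Rightarrow> 'e \<Rightarrow> real" where
  "vartheta n M D l k p x = (let m = 6 * (k - 1); f = phi M p in
     l (m + 1) * theta n M D p (f (f x)) + l (m + 2) * theta_star n M D p (f (f x)) +
     l (m + 3) * theta n M D p (xi M p) * eta M p x +
     l (m + 4) * theta_star n M D p (xi M p) * eta M p x +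
     l (m + 5) * omega M D p x + l (m + 6) * omega M D p (f x))"

text \<open>\<open>nabla\<close> is the Levi-Civita connection, and the torsion in question is that of \<open>D\<close>. Of the
  coefficients \<open>l\<close> only \<open>l 1, \<dots>, l 18\<close> enter.\<close>

definition torsion_expressed_by_forms ::
    "nat \<Rightarrow> ('m, 'e::euclidean_space) acb \<Rightarrow> (('m \<Rightarrow> 'e) \<Rightarrow> ('m \<Rightarrow> 'e) \<Rightarrow> 'm \<Rightarrow> 'e) \<Rightarrow>
     (('m \<Rightarrow> 'e) \<Rightarrow> ('m \<Rightarrow> 'e) \<Rightarrow> 'm \<Rightarrow> 'e) \<Rightarrow> bool" where
  "torsion_expressed_by_forms n M nabla D \<longleftrightarrow>
     (\<exists>l :: nat \<Rightarrow> real. \<forall>X Y Z p.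
        vector_field (atlas M) X \<longrightarrow> vector_field (atlas M) Y \<longrightarrow> vector_field (atlas M) Z \<longrightarrow>
        (let x = X p; y = Y p; z = Z p; f = phi M p; g = met M p; \<eta> = eta M p;
             t1 = vartheta n M nabla l 1 p; t2 = vartheta n M nabla l 2 p;
             t3 = vartheta n M nabla l 3 p
         in g (torsion (atlas M) D X Y p) z =
           g (f y) (f z) * t1 x + g y (f z) * t2 x + \<eta> y * \<eta> z * t3 x -
           g (f x) (f z) * t1 y - g x (f z) * t2 y - \<eta> x * \<eta> z * t3 y))"

definition swap_diff :: "('e \<Rightarrow> 'e \<Rightarrow> 'b::minus) \<Rightarrow> 'e \<Rightarrow> 'e \<Rightarrow> 'b" where
  "swap_diff A x y = A x y - A y x"

definition pi2 :: "('m, 'e::euclidean_space) acb \<Rightarrow> 'm \<Rightarrow> 'e \<Rightarrow> 'e \<Rightarrow> 'e \<Rightarrow> 'e" where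
  "pi2 M p x y z = swap_diff (\<lambda>x y. met M p y (phi M p z) *\<^sub>R phi M p x) x y"

definition pi3 :: "('m, 'e::euclidean_space) acb \<Rightarrow> 'm \<Rightarrow> 'e \<Rightarrow> 'e \<Rightarrow> 'e \<Rightarrow> 'e" where
  "pi3 M p x y z =
     - swap_diff (\<lambda>x y. met M p y z *\<^sub>R phi M p x + met M p y (phi M p z) *\<^sub>R x) x y"

definition pi4 :: "('m, 'e::euclidean_space) acb \<Rightarrow> 'm \<Rightarrow> 'e \<Rightarrow> 'e \<Rightarrow> 'e \<Rightarrow> 'e" where
  "pi4 M p x y z =
     swap_diff (\<lambda>x y. (eta M p y * eta M p z) *\<^sub>R x + (met M p y z * eta M p x) *\<^sub>R xi M p) x y"

definition pi5 :: "('m, 'e::euclidean_space) acb \<Rightarrow> 'm \<Rightarrow> 'e \<Rightarrow> 'e \<Rightarrow> 'e \<Rightarrow> 'e" where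
  "pi5 M p x y z =
     swap_diff (\<lambda>x y. (eta M p y * eta M p z) *\<^sub>R phi M p x +
       (met M p y (phi M p z) * eta M p x) *\<^sub>R xi M p) x y"

end

theory Submission
  imports Defs "HOL-Computational_Algebra.Polynomial"
begin

text \<open>Let \<open>Q(x,y,z) = g(D\<^sub>x y - \<nabla>\<^sub>x y, z)\<close>. Both connections are metric and \<open>\<nabla>\<close> is torsion-free, so \<open>Q\<close> is
  determined by the torsion of \<open>D\<close> through Koszul's formula. For a torsion of the prescribed shape
  \<open>T(x,y,z) = S(x;y,z) - S(y;x,z)\<close>, with \<open>S\<close> symmetric in its last two arguments, it collapses to
  \<open>Q(x,y,z) = S(z;x,y) - S(y;x,z)\<close> (lemma \<open>metric_difference_from_torsion\<close>).

  That \<open>\<phi>\<close> is \<open>D\<close>-parallel means \<open>F(x,y,z) = Q(x,y,\<phi>z) - Q(x,\<phi>y,z)\<close>. Inserting \<open>S\<close> on the right and the form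
  of \<open>F\<close> in the given class on the left, both sides are built from \<open>g(\<phi>x,\<phi>y)\<close>, \<open>g(x,\<phi>y)\<close> and \<open>\<eta>(x)\<eta>(y)\<close>,
  multiplied with 1-forms in \<open>z\<close> and symmetrized in \<open>y\<close>, \<open>z\<close>. Since \<open>y\<close> and \<open>\<phi>y\<close> are independent for
  \<open>0 \<noteq> y \<in> ker \<eta>\<close>, the coefficients can be compared (\<open>symmetrized_pencil_zero\<close>), which gives
  \<open>\<vartheta>\<^sub>2 = \<vartheta>\<^sub>1 \<circ> \<phi> + \<theta>/2n\<close>, \<open>\<vartheta>\<^sub>1 + \<vartheta>\<^sub>2 \<circ> \<phi> = - \<theta>\<^sup>*/2n\<close> and \<open>\<vartheta>\<^sub>3 \<circ> \<phi> = \<omega>\<close> (\<open>natural_torsion_forms\<close>).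
  Thus \<open>\<vartheta>\<^sub>1(\<xi>)\<close> and the horizontal part of \<open>\<vartheta>\<^sub>3\<close> are prescribed and \<open>\<vartheta>\<^sub>1\<close> determines \<open>\<vartheta>\<^sub>2\<close>; only the
  horizontal part of \<open>\<vartheta>\<^sub>1\<close> remains, and it equals \<open>g(\<phi> \<cdot>, q)\<close> where \<open>\<alpha>\<^sub>1, \<alpha>\<^sub>2, \<alpha>\<^sub>3, \<alpha>\<^sub>4\<close> are the coefficients \<open>\<lambda>\<^sub>1, \<lambda>\<^sub>2, \<lambda>\<^sub>5, \<lambda>\<^sub>6\<close> of
  \<open>\<vartheta>\<^sub>1\<close>. Rewriting \<open>T\<close> accordingly yields the formula (\<open>natural_torsion_formula\<close>). The argument is
  pointwise, while the \<open>\<lambda>\<^sub>i\<close> are global constants, so the same \<open>\<alpha>\<^sub>i\<close> serve at every point.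

  To argue pointwise, every tangent vector has to be the value of a smooth vector field; this also
  makes \<open>\<theta>\<close>, \<open>\<theta>\<^sup>*\<close>, \<open>\<omega>\<close> linear and gives their metric duals a meaning. Such fields are obtained with a bump
  function in a chart (\<open>vector_field_extends\<close>), for which the calculus of \<open>Ck_on\<close> is developed first.\<close>

section \<open>Calculus of smooth functions\<close>

lemma Ck_on_cong:
  assumes "open S" "\<And>x. x \<in> S \<Longrightarrow> f x = g x" "Ck_on k f S"
  shows "Ck_on k g S"
  using assms(2,3)
proof (induction k arbitrary: f g)
  case 0
  then show ?case using continuous_on_cong by fastforce
next
  case (Suc k)
  have D: "(g has_derivative frechet_derivative f (at x)) (at x)" if "x \<in> S" for x
  proof (rule has_derivative_transform_within_open[OF _ \<open>open S\<close> that])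
    show "(f has_derivative frechet_derivative f (at x)) (at x)"
      using Suc.prems(2) that frechet_derivative_works by auto
  qed (use Suc.prems(1) in auto)
  have "Ck_on k (\<lambda>x. frechet_derivative g (at x) v) S" for v
  proof (rule Suc.IH)
    show "Ck_on k (\<lambda>x. frechet_derivative f (at x) v) S" using Suc.prems(2) by simp
    show "frechet_derivative f (at x) v = frechet_derivative g (at x) v" if "x \<in> S" for x
      using frechet_derivative_at[OF D[OF that]] by simp
  qed
  moreover have "g differentiable (at x)" if "x \<in> S" for x
    using D[OF that] by (rule differentiableI)
  ultimately show ?case by simp
qed

text \<open>The definition of \<open>Ck_on\<close> speaks of the values of \<open>frechet_derivative\<close>. This rule lets any explicit
  formula for the derivative take their place, so that the closure properties below become
  inductions in which the product or chain rule supplies the formula.\<close>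

lemma Ck_on_SucI:
  assumes "open S" "\<And>x. x \<in> S \<Longrightarrow> (f has_derivative f' x) (at x)"
    and "\<And>v. Ck_on k (\<lambda>x. f' x v) S"
  shows "Ck_on (Suc k) f S"
proof -
  have "Ck_on k (\<lambda>x. frechet_derivative f (at x) v) S" for v
    by (rule Ck_on_cong[OF assms(1) _ assms(3)[of v]])
      (use assms(2) frechet_derivative_at in metis)
  moreover have "f differentiable (at x)" if "x \<in> S" for x
    using assms(2)[OF that] by (rule differentiableI)
  ultimately show ?thesis by simp
qed

lemma Ck_on_Suc_D:
  assumes "Ck_on (Suc k) f S" "x \<in> S"
  shows "(f has_derivative frechet_derivative f (at x)) (at x)"
  using assms frechet_derivative_works by auto

lemma Ck_on_Suc_imp: "Ck_on (Suc k) f S \<Longrightarrow> Ck_on k f S"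
proof (induction k arbitrary: f)
  case 0
  then show ?case
    by (auto intro!: differentiable_imp_continuous_on
        simp: differentiable_on_def differentiable_at_withinI)
next
  case (Suc k)
  from Suc.prems have "Ck_on (Suc k) (\<lambda>x. frechet_derivative f (at x) v) S" for v
    unfolding Ck_on.simps(2)[of "Suc k"] by blast
  then have "Ck_on k (\<lambda>x. frechet_derivative f (at x) v) S" for v
    by (rule Suc.IH)
  with Suc.prems show ?case unfolding Ck_on.simps(2)[of _ f] by blast
qed

text \<open>Smoothness is local. A field that is cut off by a bump function is smooth because it is smooth
  near the support and vanishes away from it.\<close>

lemma Ck_on_local:
  assumes "\<And>x. x \<in> S \<Longrightarrow> \<exists>U. open U \<and> x \<in> U \<and> Ck_on k f U"
  shows "Ck_on k f S"
  using assms
proof (induction k arbitrary: f)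
  case 0
  have "isCont f x" if x: "x \<in> S" for x
  proof -
    obtain U where "open U" "x \<in> U" "Ck_on 0 f U" using 0[OF x] by blast
    then show ?thesis by (simp add: continuous_on_eq_continuous_at)
  qed
  then show ?case by (simp add: continuous_at_imp_continuous_on)
next
  case (Suc k)
  have "f differentiable (at x) \<and>
      (\<exists>U. open U \<and> x \<in> U \<and> Ck_on k (\<lambda>x. frechet_derivative f (at x) v) U)"
    if x: "x \<in> S" for x v
  proof -
    obtain U where "open U" "x \<in> U" "Ck_on (Suc k) f U" using Suc.prems[OF x] by blast
    then show ?thesis by auto
  qed
  then show ?case using Suc.IH by simp
qed

lemma Ck_on_const: "open S \<Longrightarrow> Ck_on k (\<lambda>x. c) S"
proof (induction k arbitrary: c)
  case (Suc k)
  show ?case by (rule Ck_on_SucI[OF Suc.prems, of _ "\<lambda>x v. 0"]) (auto intro: Suc)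
qed simp

lemma Ck_on_bounded_linear_compose:
  assumes "open S" "bounded_linear L" "Ck_on k f S"
  shows "Ck_on k (\<lambda>x. L (f x)) S"
  using assms(3)
proof (induction k arbitrary: f)
  case 0
  then show ?case using assms(2) by (simp add: bounded_linear.continuous_on)
next
  case (Suc k)
  show ?case
  proof (rule Ck_on_SucI[OF assms(1)])
    show "((\<lambda>x. L (f x)) has_derivative (\<lambda>v. L (frechet_derivative f (at x) v))) (at x)"
      if "x \<in> S" for x
      using bounded_linear.has_derivative[OF assms(2) Ck_on_Suc_D[OF Suc.prems that]] .
    show "Ck_on k (\<lambda>x. L (frechet_derivative f (at x) v)) S" for v
      using Suc by simp
  qed
qed

lemma Ck_on_add:
  assumes "open S" "Ck_on k f S" "Ck_on k g S"
  shows "Ck_on k (\<lambda>x. f x + g x) S"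
  using assms(2,3)
proof (induction k arbitrary: f g)
  case 0
  then show ?case by (simp add: continuous_on_add)
next
  case (Suc k)
  show ?case
  proof (rule Ck_on_SucI[OF assms(1)])
    show "((\<lambda>x. f x + g x) has_derivative
        (\<lambda>v. frechet_derivative f (at x) v + frechet_derivative g (at x) v)) (at x)"
      if "x \<in> S" for x
      by (rule has_derivative_add[OF Ck_on_Suc_D[OF Suc.prems(1) that]
          Ck_on_Suc_D[OF Suc.prems(2) that]])
  qed (use Suc in simp)
qed

lemma Ck_on_sum:
  assumes "open S" "\<And>i. i \<in> I \<Longrightarrow> Ck_on k (f i) S"
  shows "Ck_on k (\<lambda>x. \<Sum>i\<in>I. f i x) S"
  using assms(2)
  by (induction I rule: infinite_finite_induct)
    (simp_all add: Ck_on_const Ck_on_add \<open>open S\<close>)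

lemma Ck_on_scaleR:
  fixes f :: "'a::euclidean_space \<Rightarrow> real"
  assumes "open S" "Ck_on k f S" "Ck_on k g S"
  shows "Ck_on k (\<lambda>x. f x *\<^sub>R g x) S"
  using assms(2,3)
proof (induction k arbitrary: f g)
  case 0
  then show ?case by (simp add: continuous_on_scaleR)
next
  case (Suc k)
  show ?case
  proof (rule Ck_on_SucI[OF assms(1)])
    show "((\<lambda>x. f x *\<^sub>R g x) has_derivative
        (\<lambda>v. f x *\<^sub>R frechet_derivative g (at x) v + frechet_derivative f (at x) v *\<^sub>R g x)) (at x)"
      if "x \<in> S" for x
      by (rule has_derivative_scaleR[OF Ck_on_Suc_D[OF Suc.prems(1) that]
          Ck_on_Suc_D[OF Suc.prems(2) that]])
    show "Ck_on k (\<lambda>x. f x *\<^sub>R frechet_derivative g (at x) v +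
        frechet_derivative f (at x) v *\<^sub>R g x) S" for v
      using Ck_on_add[OF assms(1) Suc.IH[OF Ck_on_Suc_imp[OF Suc.prems(1)]] Suc.IH[OF _ Ck_on_Suc_imp[OF Suc.prems(2)]]]
        Suc.prems by simp
  qed
qed

text \<open>The derivative of \<open>f \<circ> g\<close> along \<open>v\<close> is, in coordinates, a sum of products of a component of
  \<open>Dg\<close> with a partial derivative of \<open>f\<close> evaluated along \<open>g\<close>. The latter is again a composite with
  an outer function one degree less smooth, to which the induction hypothesis applies.\<close>

lemma Ck_on_compose:
  fixes g :: "'a::euclidean_space \<Rightarrow> 'b::euclidean_space"
  assumes "open S" "open T" "g ` S \<subseteq> T" "Ck_on k g S" "Ck_on k f T"
  shows "Ck_on k (\<lambda>x. f (g x)) S"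
  using assms(4,5)
proof (induction k arbitrary: f)
  case 0
  then show ?case using continuous_on_compose2[OF _ _ assms(3)] by simp
next
  case (Suc k)
  let ?f' = "\<lambda>x v. \<Sum>b\<in>Basis. (frechet_derivative g (at x) v \<bullet> b) *\<^sub>R frechet_derivative f (at (g x)) b"
  show ?case
  proof (rule Ck_on_SucI[OF assms(1)])
    fix x assume x: "x \<in> S"
    have g: "(g has_derivative frechet_derivative g (at x)) (at x)"
      using Ck_on_Suc_D[OF Suc.prems(1) x] .
    have f: "(f has_derivative frechet_derivative f (at (g x))) (at (g x))"
      using Ck_on_Suc_D[OF Suc.prems(2)] x assms(3) by blast
    have lin: "linear (frechet_derivative f (at (g x)))"
      using f by (rule has_derivative_linear)
    have "frechet_derivative f (at (g x)) w
        = (\<Sum>b\<in>Basis. (w \<bullet> b) *\<^sub>R frechet_derivative f (at (g x)) b)" for w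
      using arg_cong[OF euclidean_representation[of w], of "frechet_derivative f (at (g x))"]
      by (simp add: linear_sum[OF lin] linear_cmul[OF lin])
    then have "frechet_derivative f (at (g x)) \<circ> frechet_derivative g (at x) = ?f' x"
      by (intro ext) (unfold o_apply)
    then show "((\<lambda>x. f (g x)) has_derivative ?f' x) (at x)"
      using diff_chain_at[OF g f] by (simp add: o_def)
  next
    fix v
    have "Ck_on k (\<lambda>x. frechet_derivative f (at (g x)) b) S" for b
      by (rule Suc.IH[OF Ck_on_Suc_imp[OF Suc.prems(1)]]) (use Suc.prems(2) in simp)
    moreover have "Ck_on k (\<lambda>x. frechet_derivative g (at x) v \<bullet> b) S" for b
      by (rule Ck_on_bounded_linear_compose[OF assms(1) bounded_linear_inner_left])
        (use Suc.prems(1) in simp)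
    ultimately show "Ck_on k (\<lambda>x. ?f' x v) S"
      by (intro Ck_on_sum Ck_on_scaleR assms(1))
  qed
qed

section \<open>Bump functions\<close>

text \<open>The functions \<open>P (1/t) e\<^bsup>-1/t\<^esup>\<close> on the positive half-line, extended by zero. Admitting all
  polynomials \<open>P\<close> makes the family closed under differentiation, so smoothness of all its members
  can be proved by one induction.\<close>

definition flat :: "real poly \<Rightarrow> real \<Rightarrow> real" where
  "flat p t = (if t > 0 then poly p (1 / t) * exp (- (1 / t)) else 0)"

text \<open>Substituting \<open>s = 1/t\<close>, the exponential beats every polynomial at infinity.\<close>

lemma flat_tendsto_0: "(flat p \<longlongrightarrow> 0) (at 0)"
proof -
  have "((\<lambda>s. \<Sum>i\<le>degree p. coeff p i * (s ^ i / exp s)) \<longlongrightarrow> (\<Sum>i\<le>degree p. coeff p i * 0)) at_top"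
    by (intro tendsto_sum tendsto_mult tendsto_const tendsto_power_div_exp_0)
  then have "((\<lambda>s. poly p s * exp (- s)) \<longlongrightarrow> 0) at_top"
    by (simp add: poly_altdef exp_minus divide_inverse sum_distrib_right mult.assoc)
  then have "((\<lambda>t. poly p (inverse t) * exp (- inverse t)) \<longlongrightarrow> 0) (at_right 0)"
    by (rule filterlim_compose[OF _ filterlim_inverse_at_top_right])
  then have "(flat p \<longlongrightarrow> 0) (at_right 0)"
    by (rule Lim_transform_eventually)
      (rule eventually_mono[OF eventually_at_right_less], simp add: flat_def inverse_eq_divide)
  moreover have "(flat p \<longlongrightarrow> 0) (at_left 0)"
    by (rule Lim_transform_eventually[OF tendsto_const])
      (auto simp: flat_def eventually_at_filter)
  ultimately show ?thesis by (simp add: filterlim_split_at)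
qed

text \<open>With \<open>s = 1/t\<close> one has \<open>ds/dt = - s\<^sup>2\<close>, whence the polynomial \<open>s\<^sup>2 (P - P')\<close>. At \<open>t = 0\<close> the
  difference quotient of the function given by \<open>P\<close> is the function given by \<open>s P\<close>, which tends to
  zero.\<close>

lemma flat_has_derivative:
  "(flat p has_real_derivative flat (monom 1 2 * (p - pderiv p)) t) (at t)"
proof -
  consider "t > 0" | "t < 0" | "t = 0" by linarith
  then show ?thesis
  proof cases
    case 1
    have "((\<lambda>t. poly p (1 / t) * exp (- (1 / t))) has_real_derivative
        flat (monom 1 2 * (p - pderiv p)) t) (at t)"
      using 1
      by (auto intro!: derivative_eq_intros DERIV_chain2[OF poly_DERIV]
          simp: flat_def poly_monom field_simps power2_eq_square)
    then show ?thesis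
      by (rule has_field_derivative_transform_within_open[where S = "{0<..}"])
        (use 1 in \<open>auto simp: flat_def\<close>)
  next
    case 2
    have "((\<lambda>t. 0) has_real_derivative 0) (at t)" by simp
    then have "(flat p has_real_derivative 0) (at t)"
      by (rule has_field_derivative_transform_within_open[where S = "{..<0}"])
        (use 2 in \<open>auto simp: flat_def\<close>)
    then show ?thesis using 2 by (simp add: flat_def)
  next
    case 3
    have "(flat p (0 + h) - flat p 0) / h = flat (pCons 0 p) h" for h
      by (simp add: flat_def)
    then have "(flat p has_real_derivative 0) (at 0)"
      unfolding DERIV_def by (simp only: flat_tendsto_0)
    then show ?thesis using 3 by (simp add: flat_def)
  qed
qed

lemma Ck_on_flat: "Ck_on k (flat p) UNIV"
proof (induction k arbitrary: p)
  case 0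
  show ?case
    using DERIV_isCont[OF flat_has_derivative] by (simp add: continuous_at_imp_continuous_on)
next
  case (Suc k)
  show ?case
  proof (rule Ck_on_SucI)
    show "(flat p has_derivative (\<lambda>v. flat (monom 1 2 * (p - pderiv p)) t * v)) (at t)" for t
      using flat_has_derivative by (simp add: has_field_derivative_def)
    show "Ck_on k (\<lambda>t. flat (monom 1 2 * (p - pderiv p)) t * v) UNIV" for v
      by (rule Ck_on_bounded_linear_compose[OF open_UNIV bounded_linear_mult_left Suc])
  qed simp
qed

lemma Ck_on_id: "open S \<Longrightarrow> Ck_on k (\<lambda>x. x) S"
proof (cases k)
  case (Suc j)
  assume "open S"
  then show ?thesis unfolding Suc
    by (rule Ck_on_SucI[where f' = "\<lambda>x v. v"]) (auto intro: Ck_on_const \<open>open S\<close>)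
qed simp

lemma Ck_on_inner:
  assumes "open S" "Ck_on k f S" "Ck_on k g S"
  shows "Ck_on k (\<lambda>x. (f x :: 'b::euclidean_space) \<bullet> g x) S"
proof -
  have "Ck_on k (\<lambda>x. \<Sum>b\<in>Basis. (f x \<bullet> b) *\<^sub>R (g x \<bullet> b)) S"
    by (intro Ck_on_sum Ck_on_scaleR assms(1)
       Ck_on_bounded_linear_compose[OF assms(1) bounded_linear_inner_left] assms)
  then show ?thesis unfolding real_scaleR_def by (subst euclidean_inner)
qed

lemma bump_function:
  fixes a :: "'e::euclidean_space"
  assumes "r > 0"
  obtains \<beta> :: "'e \<Rightarrow> real"
  where "smooth_on \<beta> UNIV" "\<beta> a = 1" "\<And>x. x \<notin> cball a r \<Longrightarrow> \<beta> x = 0"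
proof
  let ?s = "\<lambda>x. r\<^sup>2 + - ((x + - a) \<bullet> (x + - a))"
  let ?\<beta> = "\<lambda>x. flat 1 (?s x) / flat 1 (r\<^sup>2)"
  have pos: "flat 1 (r\<^sup>2) > 0" using assms by (simp add: flat_def)
  have diff: "Ck_on k (\<lambda>x. x + - a) UNIV" for k
    by (intro Ck_on_add Ck_on_id Ck_on_const open_UNIV)
  have s: "Ck_on k ?s UNIV" for k
    by (intro Ck_on_add Ck_on_const open_UNIV
       Ck_on_bounded_linear_compose[OF open_UNIV bounded_linear_minus[OF bounded_linear_ident]]
       Ck_on_inner[OF open_UNIV diff diff])
  have *: "Ck_on k (\<lambda>x. flat 1 (?s x)) UNIV" for k
    by (rule Ck_on_compose[OF open_UNIV open_UNIV subset_UNIV s Ck_on_flat])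
  show "smooth_on ?\<beta> UNIV"
    unfolding smooth_on_def
    by (intro allI Ck_on_bounded_linear_compose[OF open_UNIV bounded_linear_divide])
      (rule *)
  show "?\<beta> a = 1" using pos by simp
  show "?\<beta> x = 0" if "x \<notin> cball a r" for x
  proof -
    have "norm (x - a) > r" using that by (simp add: dist_norm norm_minus_commute)
    then have "r\<^sup>2 \<le> (norm (x - a))\<^sup>2" using assms by (intro power_mono) auto
    then show ?thesis by (simp add: flat_def power2_norm_eq_inner)
  qed
qed

section \<open>Extending tangent vectors to vector fields\<close>

definition jacobian ::
    "('m, 'e::euclidean_space) chart \<Rightarrow> ('m, 'e) chart \<Rightarrow> 'm \<Rightarrow> 'e \<Rightarrow> 'e" where
  "jacobian c c' q = frechet_derivative (snd c' \<circ> chart_inv c) (at (snd c q))"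

locale smooth_manifold =
  fixes A :: "('m::{t2_space,second_countable_topology}, 'e::euclidean_space) chart set"
  assumes smooth_atlas: "smooth_atlas A"
begin

lemma chart_homeomorphism:
  assumes "c \<in> A"
  shows "open (fst c)" "open (snd c ` fst c)"
    and "homeomorphism (fst c) (snd c ` fst c) (snd c) (chart_inv c)"
  using smooth_atlas assms unfolding smooth_atlas_def by blast+

lemma chart_inv_chart: "c \<in> A \<Longrightarrow> q \<in> fst c \<Longrightarrow> chart_inv c (snd c q) = q"
  using homeomorphism_apply1[OF chart_homeomorphism(3)] .

lemma open_chart_image:
  assumes "c \<in> A" "open T" "T \<subseteq> fst c"
  shows "open (snd c ` T)"
proof -
  have "openin (top_of_set (snd c ` fst c)) (snd c ` T)"
    by (rule homeomorphism_imp_open_map[OF chart_homeomorphism(3)[OF assms(1)]])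
      (use assms openin_open_eq chart_homeomorphism(1) in blast)
  then show ?thesis using openin_open_eq chart_homeomorphism(2)[OF assms(1)] by blast
qed

lemma transition_smooth:
  assumes "c \<in> A" "c' \<in> A"
  shows "Ck_on k (snd c' \<circ> chart_inv c) (snd c ` (fst c \<inter> fst c'))"
  using smooth_atlas assms unfolding smooth_atlas_def smooth_on_def by blast

lemma open_overlap_image: "c \<in> A \<Longrightarrow> c' \<in> A \<Longrightarrow> open (snd c ` (fst c \<inter> fst c'))"
  by (intro open_chart_image open_Int chart_homeomorphism) auto

lemma transition_has_derivative:
  assumes "c \<in> A" "c' \<in> A" "q \<in> fst c" "q \<in> fst c'"
  shows "((snd c' \<circ> chart_inv c) has_derivative jacobian c c' q) (at (snd c q))"
  unfolding jacobian_def
  by (rule Ck_on_Suc_D[OF transition_smooth[OF assms(1,2), of "Suc 0"]]) (use assms in auto)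

lemma jacobian_self:
  assumes "c \<in> A" "q \<in> fst c"
  shows "jacobian c c q v = v"
proof -
  have "((\<lambda>x. x) has_derivative jacobian c c q) (at (snd c q))"
    by (rule has_derivative_transform_within_open[OF
          transition_has_derivative[OF assms(1,1) assms(2,2)] chart_homeomorphism(2)[OF assms(1)]])
      (use assms in \<open>auto simp: chart_inv_chart[OF assms(1)]\<close>)
  then show ?thesis using has_derivative_unique[OF _ has_derivative_ident] by metis
qed

lemma jacobian_cocycle:
  assumes "c \<in> A" "c' \<in> A" "c'' \<in> A" "q \<in> fst c" "q \<in> fst c'" "q \<in> fst c''"
  shows "jacobian c' c'' q (jacobian c c' q v) = jacobian c c'' q v"
proof -
  have q: "(snd c' \<circ> chart_inv c) (snd c q) = snd c' q"
    using assms by (simp add: chart_inv_chart)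
  have "(((snd c'' \<circ> chart_inv c') \<circ> (snd c' \<circ> chart_inv c)) has_derivative
      (jacobian c' c'' q \<circ> jacobian c c' q)) (at (snd c q))"
    by (rule diff_chain_at) (use assms q transition_has_derivative in auto)
  then have "((snd c'' \<circ> chart_inv c) has_derivative (jacobian c' c'' q \<circ> jacobian c c' q))
      (at (snd c q))"
    by (rule has_derivative_transform_within_open[OF _ open_overlap_image[OF assms(1,2)]])
      (use assms in \<open>auto simp: chart_inv_chart[OF assms(1)] chart_inv_chart[OF assms(2)]\<close>)
  from has_derivative_unique[OF this transition_has_derivative] assms show ?thesis
    by (metis comp_apply)
qed

lemma chart_at: "chart_at A p \<in> A" "p \<in> fst (chart_at A p)"
proof -
  have "\<exists>c. c \<in> A \<and> p \<in> fst c" using smooth_atlas unfolding smooth_atlas_def by blast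
  from someI_ex[OF this] show "chart_at A p \<in> A" "p \<in> fst (chart_at A p)"
    unfolding chart_at_def by auto
qed

text \<open>The field with constant components \<open>v\<close> in the chart at \<open>p\<close>, multiplied by a bump function. In a
  second chart its components are the bump function times a column combination of the Jacobian of the
  coordinate change, which is smooth on the overlap. As the manifold is Hausdorff, the compact
  support is closed, so the extension by zero is smooth on the rest of the second chart.\<close>

lemma vector_field_extends: "\<exists>X. vector_field A X \<and> X p = v"
proof -
  define c0 where "c0 = chart_at A p"
  have c0: "c0 \<in> A" "p \<in> fst c0" using chart_at c0_def by auto
  obtain r where r: "r > 0" "cball (snd c0 p) r \<subseteq> snd c0 ` fst c0"
    using open_contains_cball chart_homeomorphism(2)[OF c0(1)] c0(2) by blast
  obtain \<beta> :: "'e \<Rightarrow> real" where \<beta>: "smooth_on \<beta> UNIV" "\<beta> (snd c0 p) = 1"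
    and \<beta>0: "\<And>x. x \<notin> cball (snd c0 p) r \<Longrightarrow> \<beta> x = 0"
    using bump_function[OF r(1)] by metis
  define K where "K = chart_inv c0 ` cball (snd c0 p) r"
  have "compact K"
    unfolding K_def
    by (rule compact_continuous_image[OF continuous_on_subset[OF _ r(2)] compact_cball])
      (rule homeomorphism_cont2[OF chart_homeomorphism(3)[OF c0(1)]])
  then have K: "closed K" by (rule compact_imp_closed)
  have notK: "\<beta> (snd c0 q) = 0" if "q \<in> fst c0" "q \<notin> K" for q
    by (rule \<beta>0) (use that chart_inv_chart[OF c0(1) that(1)] K_def in force)
  define X where "X q = (if q \<in> fst c0 then \<beta> (snd c0 q) *\<^sub>R jacobian c0 (chart_at A q) q v else 0)"
    for q
  have rep: "components A c q (X q) = (if q \<in> fst c0 then \<beta> (snd c0 q) *\<^sub>R jacobian c0 c q v else 0)"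
    if c: "c \<in> A" "q \<in> fst c" for c q
  proof -
    have lin: "linear (jacobian (chart_at A q) c q)"
      using transition_has_derivative[OF chart_at(1) c(1) chart_at(2) c(2)]
      by (rule has_derivative_linear)
    have "components A c q w = jacobian (chart_at A q) c q w" for w
      by (simp add: components_def jacobian_def)
    then show ?thesis
      using jacobian_cocycle[OF c0(1) chart_at(1) c(1) _ chart_at(2) c(2)]
      by (simp add: X_def linear_cmul[OF lin] linear_0[OF lin])
  qed
  have "Ck_on k (local_rep A c X) (snd c ` fst c)" if c: "c \<in> A" for c k
  proof -
    let ?W = "snd c ` (fst c \<inter> fst c0)" and ?W' = "snd c ` (fst c - K)"
    let ?\<tau> = "snd c0 \<circ> chart_inv c"
    have W: "open ?W" using open_overlap_image c c0(1) .
    have W': "open ?W'"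
      by (rule open_chart_image[OF c]) (use K chart_homeomorphism(1)[OF c] in auto)
    have \<tau>: "Ck_on k ?\<tau> ?W" using transition_smooth[OF c c0(1)] .
    have "Ck_on k (\<lambda>x. \<beta> (?\<tau> x)) ?W"
      by (rule Ck_on_compose[OF W open_UNIV subset_UNIV \<tau>]) (use \<beta>(1) smooth_on_def in blast)
    moreover have "Ck_on k (\<lambda>x. frechet_derivative (snd c \<circ> chart_inv c0) (at (?\<tau> x)) v) ?W"
    proof (rule Ck_on_compose[OF W open_overlap_image[OF c0(1) c] _ \<tau>])
      show "?\<tau> ` ?W \<subseteq> snd c0 ` (fst c0 \<inter> fst c)" using chart_inv_chart[OF c] by auto
      show "Ck_on k (\<lambda>y. frechet_derivative (snd c \<circ> chart_inv c0) (at y) v)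
          (snd c0 ` (fst c0 \<inter> fst c))"
        using transition_smooth[OF c0(1) c, of "Suc k"] by simp
    qed
    ultimately have "Ck_on k (\<lambda>x. \<beta> (?\<tau> x) *\<^sub>R
        frechet_derivative (snd c \<circ> chart_inv c0) (at (?\<tau> x)) v) ?W"
      by (rule Ck_on_scaleR[OF W])
    then have 1: "Ck_on k (local_rep A c X) ?W"
      by (rule Ck_on_cong[OF W, rotated])
        (auto simp: local_rep_def chart_inv_chart[OF c] rep[OF c] jacobian_def)
    have 2: "Ck_on k (local_rep A c X) ?W'"
      by (rule Ck_on_cong[OF W' _ Ck_on_const[OF W', of _ 0]])
        (auto simp: local_rep_def chart_inv_chart[OF c] rep[OF c] notK)
    have "K \<subseteq> fst c0"
      unfolding K_def using r(2) chart_inv_chart[OF c0(1)] by fastforce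
    then have "x \<in> ?W \<or> x \<in> ?W'" if "x \<in> snd c ` fst c" for x using that by blast
    then show ?thesis using 1 2 W W' by (intro Ck_on_local) blast
  qed
  then have "vector_field A X" unfolding vector_field_def smooth_on_def by blast
  moreover have "X p = v"
    using c0(2) \<beta>(2) jacobian_self[OF c0] by (simp add: X_def c0_def[symmetric])
  ultimately show ?thesis by blast
qed

lemma field_through: "vector_field A (field_through A p v)" "field_through A p v p = v"
  using someI_ex[OF vector_field_extends[of p v]] unfolding field_through_def by auto

end

section \<open>Linear algebra of a tangent space\<close>

lemma has_signature_nondegenerate:
  assumes "has_signature B r s" "bilinear B" "\<And>u. B u v = 0"
  shows "v = 0"
proof -
  obtain N P where S: "finite (N \<union> P)" "span (N \<union> P) = UNIV"
    and orth: "\<And>u w. u \<in> N \<union> P \<Longrightarrow> w \<in> N \<union> P \<Longrightarrow> u \<noteq> w \<Longrightarrow> B u w = 0"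
    and unit: "\<And>u. u \<in> N \<Longrightarrow> B u u = - 1" "\<And>u. u \<in> P \<Longrightarrow> B u u = 1"
    using assms(1) unfolding has_signature_def by auto
  from S obtain c where v: "v = (\<Sum>w\<in>N \<union> P. c w *\<^sub>R w)"
    unfolding span_finite[OF S(1)] by blast
  have "c u = 0" if u: "u \<in> N \<union> P" for u
  proof -
    have lin: "linear (B u)" using assms(2) by (simp add: bilinear_def)
    have "0 = (\<Sum>w\<in>N \<union> P. c w * B u w)"
      using assms(3)[of u] unfolding v by (simp add: linear_sum[OF lin] linear_cmul[OF lin])
    also have "\<dots> = (\<Sum>w\<in>N \<union> P. if w = u then c u * B u u else 0)"
      by (rule sum.cong) (use orth u in auto)
    also have "\<dots> = c u * B u u" using S(1) u by simp
    finally show ?thesis using unit u by fastforce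
  qed
  then show ?thesis unfolding v by (simp add: sum.neutral)
qed

text \<open>The map \<open>L\<close> that sends \<open>v\<close> to the Euclidean representative of \<open>\<lambda>u. B u v\<close> is injective because \<open>B\<close>
  is nondegenerate, hence surjective by dimension.\<close>

lemma nondegenerate_riesz:
  fixes B :: "'e::euclidean_space \<Rightarrow> 'e \<Rightarrow> real"
  assumes "bilinear B" "\<And>v. (\<And>u. B u v = 0) \<Longrightarrow> v = 0" "linear \<alpha>"
  shows "\<exists>!v. \<forall>u. \<alpha> u = B u v"
proof -
  have lin: "linear (B u)" "linear (\<lambda>u. B u v)" for u v
    using assms(1) by (auto simp: bilinear_def)
  define L where "L v = (\<Sum>b\<in>Basis. B b v *\<^sub>R b)" for v
  have L: "L v \<bullet> b = B b v" if "b \<in> Basis" for b v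
    using that by (simp add: L_def inner_sum_left inner_Basis if_distrib sum.delta cong: if_cong)
  have linL: "linear L"
    unfolding L_def
    by (rule linearI) (simp_all add: linear_add[OF lin(1)] linear_cmul[OF lin(1)]
        scaleR_add_left sum.distrib scaleR_sum_right)
  have expand: "\<phi> u = (\<Sum>b\<in>Basis. (u \<bullet> b) * \<phi> b)" if "linear \<phi>" for \<phi> :: "'e \<Rightarrow> real" and u
    by (subst euclidean_representation[symmetric])
      (simp add: linear_sum[OF that] linear_cmul[OF that])
  have inj: "inj L"
    unfolding linear_injective_0[OF linL]
  proof (intro allI impI)
    fix v assume "L v = 0"
    then have "B b v = 0" if "b \<in> Basis" for b using L[OF that, of v] by simp
    then have "B u v = 0" for u unfolding expand[OF lin(2), of u] by simp
    then show "v = 0" by (rule assms(2))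
  qed
  then have "surj L" using linear_injective_imp_surjective[OF linL] by blast
  then obtain v where v: "L v = (\<Sum>b\<in>Basis. \<alpha> b *\<^sub>R b)" by (metis surjD)
  have "\<alpha> b = B b v" if "b \<in> Basis" for b
    using L[OF that, of v] that unfolding v
    by (simp add: inner_sum_left inner_Basis if_distrib sum.delta cong: if_cong)
  then have "\<alpha> u = B u v" for u
    unfolding expand[OF assms(3), of u] expand[OF lin(2), of u] by simp
  moreover have "w = v" if "\<forall>u. \<alpha> u = B u w" for w
  proof -
    have "B u (w - v) = 0" for u
      using that calculation[of u] by (simp add: linear_diff[OF lin(1)])
    then show ?thesis using assms(2)[of "w - v"] by simp
  qed
  ultimately show ?thesis by blast
qed

text \<open>The structure that an almost contact B-metric induces on one tangent space. The theorem is a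
  pointwise identity between tensors, and all of its algebra takes place here.\<close>

locale almost_contact_B_space =
  fixes f :: "'e::euclidean_space \<Rightarrow> 'e" and \<xi> :: 'e and \<eta> :: "'e \<Rightarrow> real"
    and g :: "'e \<Rightarrow> 'e \<Rightarrow> real"
  assumes f_linear: "linear f" and eta_linear: "linear \<eta>" and g_bilinear: "bilinear g"
    and g_sym: "g x y = g y x"
    and nondegenerate: "(\<And>u. g u v = 0) \<Longrightarrow> v = 0"
    and f_xi [simp]: "f \<xi> = 0" and f_f: "f (f x) = - x + \<eta> x *\<^sub>R \<xi>"
    and eta_f [simp]: "\<eta> (f x) = 0" and eta_xi [simp]: "\<eta> \<xi> = 1"
    and g_f_f: "g x y = - g (f x) (f y) + \<eta> x * \<eta> y"
begin

lemmas lin_simps = linear_add[OF f_linear] linear_diff[OF f_linear] linear_cmul[OF f_linear]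
  linear_neg[OF f_linear] linear_0[OF f_linear]
  linear_add[OF eta_linear] linear_diff[OF eta_linear] linear_cmul[OF eta_linear]
  linear_neg[OF eta_linear] linear_0[OF eta_linear]
  bilinear_ladd[OF g_bilinear] bilinear_radd[OF g_bilinear]
  bilinear_lsub[OF g_bilinear] bilinear_rsub[OF g_bilinear]
  bilinear_lmul[OF g_bilinear] bilinear_rmul[OF g_bilinear]
  bilinear_lneg[OF g_bilinear] bilinear_rneg[OF g_bilinear]
  bilinear_lzero[OF g_bilinear] bilinear_rzero[OF g_bilinear]

lemma g_xi: "g \<xi> y = \<eta> y"
  using g_f_f[of \<xi> y] by (simp add: lin_simps)

lemma g_f_left: "g (f x) y = g x (f y)"
  using g_f_f[of "f x" y] g_xi[of "f y"] by (simp add: f_f lin_simps)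

text \<open>On \<open>ker \<eta>\<close> the two forms are \<open>- g x y\<close> and \<open>g x (f y)\<close>, so the hypothesis says that
  \<open>R f y - P y\<close> is orthogonal to \<open>ker \<eta>\<close>. It is orthogonal to \<open>\<xi>\<close> as well and therefore vanishes;
  but \<open>y\<close> and \<open>f y\<close> are independent because \<open>f\<close> is a complex structure on \<open>ker \<eta>\<close>.\<close>

lemma horizontal_pencil_independent:
  assumes "y \<noteq> 0" "\<eta> y = 0"
    and "\<And>x. \<eta> x = 0 \<Longrightarrow> g (f x) (f y) * P + g x (f y) * R = 0"
  shows "P = 0 \<and> R = 0"
proof -
  let ?w = "R *\<^sub>R f y - P *\<^sub>R y"
  have "g u ?w = 0" for u
  proof -
    define x where "x = u - \<eta> u *\<^sub>R \<xi>"
    have x: "\<eta> x = 0" "u = x + \<eta> u *\<^sub>R \<xi>" by (simp_all add: x_def lin_simps)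
    have "g x ?w = 0"
      using assms(3)[OF x(1)] g_f_f[of x y] x(1) by (simp add: lin_simps algebra_simps)
    moreover have "g \<xi> ?w = 0" using assms(2) by (simp add: g_xi lin_simps)
    ultimately have "g (x + \<eta> u *\<^sub>R \<xi>) ?w = 0"
      by (simp only: bilinear_ladd[OF g_bilinear] bilinear_lmul[OF g_bilinear]) simp
    then show ?thesis using x(2) by simp
  qed
  then have w: "?w = 0" by (rule nondegenerate)
  then have "P *\<^sub>R y = R *\<^sub>R f y" by simp
  moreover have "- R *\<^sub>R y = P *\<^sub>R f y"
    using arg_cong[OF w, of f] assms(2) by (simp add: lin_simps f_f) 
  ultimately have "(P * P + R * R) *\<^sub>R y = 0"
  proof -
    have "(R * R) *\<^sub>R y = R *\<^sub>R (R *\<^sub>R y)" by simp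
    also have "\<dots> = - (R *\<^sub>R (P *\<^sub>R f y))"
      by (simp add: \<open>- R *\<^sub>R y = P *\<^sub>R f y\<close>[symmetric])
    also have "\<dots> = - (P *\<^sub>R (P *\<^sub>R y))"
      by (simp add: \<open>P *\<^sub>R y = R *\<^sub>R f y\<close> mult.commute)
    finally show ?thesis by (simp add: scaleR_add_left)
  qed
  then show ?thesis using assms(1) by (simp add: sum_squares_eq_zero_iff)
qed

text \<open>The identity determines its three 1-forms one argument pattern at a time. For \<open>z = \<xi>\<close> and
  horizontal \<open>x\<close>, \<open>y\<close>, and then for \<open>y = z\<close> horizontal, it is the linear relation between \<open>g (f x) (f y)\<close>
  and \<open>g x (f y)\<close> that was excluded above, which kills \<open>P\<close> and \<open>R\<close> on \<open>\<xi>\<close> and on \<open>ker \<eta>\<close>; putting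
  \<open>x = y = \<xi>\<close> isolates \<open>W\<close>. Setting \<open>y = z\<close> is what makes the argument work already when \<open>ker \<eta>\<close> is a
  plane.\<close>

lemma symmetrized_pencil_zero:
  assumes "linear P" "linear R" "linear W" and hor: "h \<noteq> 0" "\<eta> h = 0"
    and eq: "\<And>x y z.
      g (f x) (f y) * P z + g x (f y) * R z + \<eta> x * \<eta> y * W z +
      (g (f x) (f z) * P y + g x (f z) * R y + \<eta> x * \<eta> z * W y) = 0"
  shows "P = (\<lambda>_. 0)" "R = (\<lambda>_. 0)" "W = (\<lambda>_. 0)"
proof -
  have xi: "P \<xi> = 0 \<and> R \<xi> = 0"
  proof (rule horizontal_pencil_independent[OF hor])
    show "g (f x) (f h) * P \<xi> + g x (f h) * R \<xi> = 0" if "\<eta> x = 0" for x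
      using eq[of x h \<xi>] that by (simp add: lin_simps)
  qed
  have hor0: "P y = 0 \<and> R y = 0" if "\<eta> y = 0" "y \<noteq> 0" for y
  proof (rule horizontal_pencil_independent[OF that(2,1)])
    show "g (f x) (f y) * P y + g x (f y) * R y = 0" if "\<eta> x = 0" for x
      using eq[of x y y] that by (simp add: algebra_simps)
  qed
  have split: "L z = 0" if "linear L" "L \<xi> = 0" "\<And>y. \<eta> y = 0 \<Longrightarrow> y \<noteq> 0 \<Longrightarrow> L y = 0"
    for L :: "'e \<Rightarrow> real" and z
  proof -
    have "L (z - \<eta> z *\<^sub>R \<xi>) = 0"
      using that(3)[of "z - \<eta> z *\<^sub>R \<xi>"] linear_0[OF that(1)]
      by (cases "z - \<eta> z *\<^sub>R \<xi> = 0") (auto simp: lin_simps)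
    then show ?thesis using that(2) by (simp add: linear_diff[OF that(1)] linear_cmul[OF that(1)])
  qed
  have W: "W z + \<eta> z * W \<xi> = 0" for z
    using eq[of \<xi> \<xi> z] by (simp add: lin_simps g_xi)
  show "P = (\<lambda>_. 0)" using split[OF assms(1)] xi hor0 by blast
  show "R = (\<lambda>_. 0)" using split[OF assms(2)] xi hor0 by blast
  show "W = (\<lambda>_. 0)" using W[of \<xi>] W by fastforce
qed


text \<open>The condition on a torsion \<open>S x y z - S y x z\<close> to come from a metric connection with parallel \<open>f\<close>.
  Here \<open>S z x y - S y x z\<close> is the difference \<open>g (D\<^sub>x y - \<nabla>\<^sub>x y) z\<close>, so the left-hand side of \<open>eq\<close> is the
  tensor \<open>F\<close> as computed from \<open>D\<close>, and the right-hand side is the form of \<open>F\<close> in the class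
  \<open>\<F>\<^sub>1 \<oplus> \<F>\<^sub>4 \<oplus> \<F>\<^sub>5 \<oplus> \<F>\<^sub>1\<^sub>1\<close>, with \<open>N = 2 n\<close>. After substitution both sides are combinations of the
  same three symmetric forms, symmetrized in \<open>y\<close>, \<open>z\<close>, and their coefficients have to agree.\<close>

lemma natural_torsion_forms:
  assumes lin: "linear t1" "linear t2" "linear t3" "linear \<theta>" "linear \<theta>s" "linear \<omega>"
    and hor: "h \<noteq> 0" "\<eta> h = 0" and "N \<noteq> 0"
    and S: "\<And>x y z. S x y z = g (f y) (f z) * t1 x + g y (f z) * t2 x + \<eta> y * \<eta> z * t3 x"
    and eq: "\<And>x y z. (S (f z) x y - S y x (f z)) - (S z x (f y) - S (f y) x z) =
      - 1 / N * (g (f x) (f y) * \<theta> z + g x (f y) * \<theta>s z - N * \<eta> x * \<eta> y * \<omega> z +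
        g (f x) (f z) * \<theta> y + g x (f z) * \<theta>s y - N * \<eta> x * \<eta> z * \<omega> y)"
  shows "t2 z = t1 (f z) + \<theta> z / N" "t1 z + t2 (f z) = - \<theta>s z / N" "t3 (f z) = \<omega> z"
proof -
  let ?P = "\<lambda>z. t1 (f z) - t2 z + \<theta> z / N"
  let ?R = "\<lambda>z. t1 z + t2 (f z) + \<theta>s z / N"
  let ?W = "\<lambda>z. t3 (f z) - \<omega> z"
  note linears = lin[THEN linear_add] lin[THEN linear_cmul]
  have "linear ?P" "linear ?R" "linear ?W"
    by (rule linearI; simp add: linears linear_add[OF f_linear] linear_cmul[OF f_linear]
        add_divide_distrib algebra_simps)+
  moreover have "g (f x) (f y) * ?P z + g x (f y) * ?R z + \<eta> x * \<eta> y * ?W z +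
      (g (f x) (f z) * ?P y + g x (f z) * ?R y + \<eta> x * \<eta> z * ?W y) = 0" for x y z
  proof -
    have 1: "g (f x) (f (f w)) = - g x (f w)" for w
      using g_f_f[of x "f w"] by simp
    have 2: "g x (f (f w)) = g (f x) (f w)" for w
      by (simp add: g_f_left)
    have "- 1 / N * (g (f x) (f y) * \<theta> z + g x (f y) * \<theta>s z - N * \<eta> x * \<eta> y * \<omega> z +
        g (f x) (f z) * \<theta> y + g x (f z) * \<theta>s y - N * \<eta> x * \<eta> z * \<omega> y) =
      - (g (f x) (f y) * (\<theta> z / N) + g x (f y) * (\<theta>s z / N) - \<eta> x * \<eta> y * \<omega> z +
        g (f x) (f z) * (\<theta> y / N) + g x (f z) * (\<theta>s y / N) - \<eta> x * \<eta> z * \<omega> y)"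
      using \<open>N \<noteq> 0\<close> by (simp add: field_simps)
    then show ?thesis
      using eq[of z x y] unfolding S eta_f 1 2 by (simp add: algebra_simps)
  qed
  ultimately have "?P = (\<lambda>_. 0)" "?R = (\<lambda>_. 0)" "?W = (\<lambda>_. 0)"
    using symmetrized_pencil_zero[OF _ _ _ hor, of ?P ?R ?W] by blast+
  from this[THEN fun_cong, of z]
  show "t2 z = t1 (f z) + \<theta> z / N" "t1 z + t2 (f z) = - \<theta>s z / N" "t3 (f z) = \<omega> z"
    by linarith+
qed

text \<open>The relations between the coefficient 1-forms fix the torsion once \<open>t1\<close> is known on \<open>ker \<eta>\<close>.
  Evaluated at \<open>\<xi>\<close> they give \<open>t1 \<xi>\<close> and \<open>t2 \<xi>\<close>; comparing the first two on \<open>ker \<eta>\<close> gives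
  \<open>g (f z) as = g z a\<close>, the familiar relation \<open>\<theta>\<^sup>* \<circ> \<phi> = \<theta>\<close>, by which the four free terms of \<open>t1\<close> are
  exactly \<open>z \<mapsto> g (f z) q\<close>. The value \<open>t3 \<xi>\<close> stays free, but \<open>\<eta> y * \<eta> z * \<eta> x\<close> drops out of the
  antisymmetrization.\<close>

lemma natural_torsion_formula:
  assumes lin: "linear t1" "linear t2" "linear t3"
    and "N \<noteq> 0"
    and t2: "\<And>z. t2 z = t1 (f z) + g z a / N"
    and R: "\<And>z. t1 z + t2 (f z) = - g z as / N"
    and t3: "\<And>z. t3 (f z) = g z ah"
    and t1: "\<And>z. t1 z = l1 * g (f (f z)) a + l2 * g (f (f z)) as + k * \<eta> z + l5 * g z ah + l6 * g (f z) ah"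
    and q: "q = l1 *\<^sub>R f (f as) - l2 *\<^sub>R f (f a) - l5 *\<^sub>R f ah + l6 *\<^sub>R ah"
  shows "g (f y) (f z) * t1 x + g y (f z) * t2 x + \<eta> y * \<eta> z * t3 x -
      g (f x) (f z) * t1 y - g x (f z) * t2 y - \<eta> x * \<eta> z * t3 y =
    g (- swap_diff (\<lambda>x y. g y z *\<^sub>R f x + g y (f z) *\<^sub>R x) x y +
       swap_diff (\<lambda>x y. (\<eta> y * \<eta> z) *\<^sub>R f x + (g y (f z) * \<eta> x) *\<^sub>R \<xi>) x y) q +
    1 / N * g (swap_diff (\<lambda>x y. g y (f z) *\<^sub>R f x) x y +
       swap_diff (\<lambda>x y. (\<eta> y * \<eta> z) *\<^sub>R x + (g y z * \<eta> x) *\<^sub>R \<xi>) x y) as +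
    1 / N * g (swap_diff (\<lambda>x y. (\<eta> y * \<eta> z) *\<^sub>R f x + (g y (f z) * \<eta> x) *\<^sub>R \<xi>) x y) a -
    g (swap_diff (\<lambda>x y. (\<eta> y * \<eta> z) *\<^sub>R f x + (g y (f z) * \<eta> x) *\<^sub>R \<xi>) x y) ah"
proof -
  have ah_xi: "\<eta> ah = 0"
    using t3[of \<xi>] linear_0[OF lin(3)] by (simp add: g_xi)
  \<comment> \<open>Replacing \<open>z\<close> by \<open>f z\<close> in the second relation and eliminating \<open>t2\<close> with the first one.\<close>
  have f_a: "g (f z) a = - g z as + \<eta> z * \<eta> as" and f_as: "g (f z) as = g z a - \<eta> z * \<eta> a" for z
  proof -
    have t2_xi: "t2 \<xi> = \<eta> a / N" using t2[of \<xi>] linear_0[OF lin(1)] by (simp add: g_xi)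
    have *: "g (f z) as = g z a - \<eta> z * \<eta> a" for z
    proof -
      have "t2 (f (f z)) = - t2 z + \<eta> z * t2 \<xi>"
        by (simp add: f_f linear_add[OF lin(2)] linear_neg[OF lin(2)] linear_diff[OF lin(2)] linear_cmul[OF lin(2)])
      then have "- g (f z) as / N = - g z a / N + \<eta> z * \<eta> a / N"
        using R[of "f z"] t2[of z] t2_xi by simp
      then show ?thesis using \<open>N \<noteq> 0\<close> by (simp add: field_simps)
    qed
    show "g (f z) as = g z a - \<eta> z * \<eta> a" by (rule *)
    show "g (f z) a = - g z as + \<eta> z * \<eta> as"
      using *[of "f z"] by (simp add: f_f lin_simps g_xi)
  qed
  have t1_xi: "t1 \<xi> = - \<eta> as / N"
    using R[of \<xi>] linear_0[OF lin(2)] by (simp add: g_xi)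
  have "k = - \<eta> as / N"
    using t1[of \<xi>] t1_xi ah_xi by (simp add: lin_simps g_xi)
  then have t1': "t1 z = l1 * (- g z a + \<eta> z * \<eta> a) + l2 * (- g z as + \<eta> z * \<eta> as)
      - \<eta> as / N * \<eta> z + l5 * g z ah + l6 * g (f z) ah" for z
    unfolding t1[of z] by (simp add: f_f lin_simps g_xi)
  have t3': "t3 z = - g (f z) ah + \<eta> z * t3 \<xi>" for z
    using t3[of "f z"]
    by (simp add: f_f linear_add[OF lin(3)] linear_neg[OF lin(3)] linear_diff[OF lin(3)] linear_cmul[OF lin(3)])
  have q': "g x q = l1 * (- g x as + \<eta> x * \<eta> as) - l2 * (- g x a + \<eta> x * \<eta> a)
      - l5 * g (f x) ah + l6 * g x ah" for x
    unfolding q by (simp add: lin_simps f_f g_f_left[symmetric] g_xi)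
      (simp add: g_sym[of x \<xi>] g_xi mult.commute)
  have hh: "g (f x) (f y) = - g x y + \<eta> x * \<eta> y" for x y
    using g_f_f[of x y] by simp
  have ff_ah: "g (f (f x)) ah = - g x ah" for x
    using ah_xi by (simp add: f_f lin_simps g_xi)
  show ?thesis
    unfolding swap_diff_def hh t2 t3'[of x] t3'[of y] t1'
    using \<open>N \<noteq> 0\<close>
    by (simp add: lin_simps q' g_xi f_a f_as hh ff_ah ah_xi field_simps)
qed

end

text \<open>The Koszul argument for the difference \<open>Q\<close> of two metric connections, one of them torsion-free.
  When the torsion is the antisymmetrization of an \<open>S\<close> that is symmetric in its last two arguments,
  two of the six terms of the usual formula cancel and the other four agree in pairs. The set \<open>V\<close> is there because connections are
  controlled on smooth vector fields only.\<close>

lemma metric_difference_from_torsion: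
  fixes Q S :: "'a \<Rightarrow> 'a \<Rightarrow> 'a \<Rightarrow> real"
  assumes V: "x \<in> V" "y \<in> V" "z \<in> V"
    and tors: "\<And>x y z. x \<in> V \<Longrightarrow> y \<in> V \<Longrightarrow> z \<in> V \<Longrightarrow> Q x y z - Q y x z = S x y z - S y x z"
    and skew: "\<And>x y z. x \<in> V \<Longrightarrow> y \<in> V \<Longrightarrow> z \<in> V \<Longrightarrow> Q x y z = - Q x z y"
    and sym: "\<And>x y z. S x y z = S x z y"
  shows "Q x y z = S z x y - S y x z"
  using tors[OF V(1,2,3)] tors[OF V(2,3,1)] tors[OF V(3,1,2)]
    skew[OF V(1,2,3)] skew[OF V(2,1,3)] skew[OF V(3,1,2)]
    sym[of x y z] sym[of y x z] sym[of z x y] by linarith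

section \<open>Natural connections\<close>

lemma exists_horizontal_vector:
  assumes "DIM('e::euclidean_space) > 1" "linear (\<eta> :: 'e \<Rightarrow> real)" "\<eta> \<xi> = 1"
  shows "\<exists>h. h \<noteq> 0 \<and> \<eta> h = 0"
proof -
  have "dim (span {\<xi>}) \<le> 1" using dim_le_card'[of "{\<xi>}"] by simp
  then have "span {\<xi>} \<noteq> UNIV" using assms(1) by (metis dim_UNIV not_le)
  then obtain v where v: "v \<notin> span {\<xi>}" by blast
  have "v - \<eta> v *\<^sub>R \<xi> \<noteq> 0"
    using v span_scale[OF span_base, of \<xi> "{\<xi>}" "\<eta> v"] by auto
  moreover have "\<eta> (v - \<eta> v *\<^sub>R \<xi>) = 0"
    using assms(3) by (simp add: linear_diff[OF assms(2)] linear_cmul[OF assms(2)])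
  ultimately show ?thesis by blast
qed

lemma almost_contact_B_space_at:
  assumes "almost_contact_B_metric n M"
  shows "almost_contact_B_space (phi M p) (xi M p) (eta M p) (met M p)"
proof (rule almost_contact_B_space.intro)
  show "(\<And>u. met M p u v = 0) \<Longrightarrow> v = 0" for v
    using assms has_signature_nondegenerate[of "met M p" n "n + 1" v]
    unfolding almost_contact_B_metric_def by blast
qed (use assms in \<open>unfold almost_contact_B_metric_def, blast\<close>)+

lemma metric_dual_eq:
  assumes "almost_contact_B_metric n M" "linear (\<alpha> p)"
  shows "\<alpha> p u = met M p u (metric_dual M \<alpha> p)"
proof -
  interpret almost_contact_B_space "phi M p" "xi M p" "eta M p" "met M p"
    using almost_contact_B_space_at[OF assms(1)] .
  show ?thesis
    using theI'[OF nondegenerate_riesz[OF g_bilinear nondegenerate assms(2)]]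
    unfolding metric_dual_def by blast
qed

text \<open>The forms are defined by evaluating \<open>F\<close> on vector fields chosen through given tangent vectors.
  Linearity in the free argument needs only that the chosen fields take the prescribed values: \<open>F\<close>
  depends on its last field through the value at the point alone. That they take these values is the
  extension of tangent vectors to vector fields.\<close>

lemma structural_forms_linear:
  assumes "almost_contact_B_metric n M"
  shows "linear (theta n M nabla p)" "linear (theta_star n M nabla p)" "linear (omega M nabla p)"
proof -
  interpret smooth_manifold "atlas M"
    by standard (use assms in \<open>simp add: almost_contact_B_metric_def\<close>)
  interpret almost_contact_B_space "phi M p" "xi M p" "eta M p" "met M p"
    using almost_contact_B_space_at[OF assms] .
  have F: "F_at M nabla p u v (w + w') = F_at M nabla p u v w + F_at M nabla p u v w'"
    "F_at M nabla p u v (c *\<^sub>R w) = c * F_at M nabla p u v w" for u v w w' c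
    unfolding F_at_def F_tensor_def field_through(2) by (simp_all add: lin_simps)
  show "linear (theta n M nabla p)" "linear (theta_star n M nabla p)" "linear (omega M nabla p)"
    by (rule linearI;
        simp add: theta_def theta_star_def omega_def contraction_def Let_def F
          distrib_left sum.distrib sum_distrib_left mult.left_commute)+
qed

theorem theorem2p1:
  fixes M :: "('m::{t2_space,second_countable_topology}, 'e::euclidean_space) acb"
    and n :: nat
    and nabla D :: "('m \<Rightarrow> 'e) \<Rightarrow> ('m \<Rightarrow> 'e) \<Rightarrow> 'm \<Rightarrow> 'e"
  assumes "n \<ge> 1"
    and "almost_contact_B_metric n M"
    and "levi_civita M nabla"
    and "class_F1_F4_F5_F11 n M nabla"
    and "natural_connection M D"
    and "torsion_expressed_by_forms n M nabla D"
  shows "\<exists>\<alpha>1 \<alpha>2 \<alpha>3 \<alpha>4 :: real. \<forall>X Y Z p.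
    vector_field (atlas M) X \<longrightarrow> vector_field (atlas M) Y \<longrightarrow> vector_field (atlas M) Z \<longrightarrow>
    (let x = X p; y = Y p; z = Z p; f = phi M p; g = met M p;
         a = metric_dual M (theta n M nabla) p;
         as = metric_dual M (theta_star n M nabla) p;
         ah = metric_dual M (omega M nabla) p;
         q = \<alpha>1 *\<^sub>R f (f as) - \<alpha>2 *\<^sub>R f (f a) - \<alpha>3 *\<^sub>R f ah + \<alpha>4 *\<^sub>R ah
     in g (torsion (atlas M) D X Y p) z =
       g (pi3 M p x y z + pi5 M p x y z) q +
       1 / (2 * real n) * g (pi2 M p x y z + pi4 M p x y z) as +
       1 / (2 * real n) * g (pi5 M p x y z) a - g (pi5 M p x y z) ah)"
proof -
  let ?VF = "Collect (vector_field (atlas M))"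
  note acb = assms(2)
  interpret smooth_manifold "atlas M"
    by standard (use acb in \<open>simp add: almost_contact_B_metric_def\<close>)
  obtain l where T: "met M p (torsion (atlas M) D X Y p) (Z p) =
      met M p (phi M p (Y p)) (phi M p (Z p)) * vartheta n M nabla l 1 p (X p) +
      met M p (Y p) (phi M p (Z p)) * vartheta n M nabla l 2 p (X p) +
      eta M p (Y p) * eta M p (Z p) * vartheta n M nabla l 3 p (X p) -
      met M p (phi M p (X p)) (phi M p (Z p)) * vartheta n M nabla l 1 p (Y p) -
      met M p (X p) (phi M p (Z p)) * vartheta n M nabla l 2 p (Y p) -
      eta M p (X p) * eta M p (Z p) * vartheta n M nabla l 3 p (Y p)"
    if "X \<in> ?VF" "Y \<in> ?VF" "Z \<in> ?VF" for X Y Z p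
    using assms(6) unfolding torsion_expressed_by_forms_def Let_def by auto
  have "(let x = X p; y = Y p; z = Z p; f = phi M p; g = met M p;
         a = metric_dual M (theta n M nabla) p;
         as = metric_dual M (theta_star n M nabla) p;
         ah = metric_dual M (omega M nabla) p;
         q = l 1 *\<^sub>R f (f as) - l 2 *\<^sub>R f (f a) - l 5 *\<^sub>R f ah + l 6 *\<^sub>R ah
     in g (torsion (atlas M) D X Y p) z =
       g (pi3 M p x y z + pi5 M p x y z) q +
       1 / (2 * real n) * g (pi2 M p x y z + pi4 M p x y z) as +
       1 / (2 * real n) * g (pi5 M p x y z) a - g (pi5 M p x y z) ah)"
    if VF: "X \<in> ?VF" "Y \<in> ?VF" "Z \<in> ?VF" for X Y Z p
  proof -
    interpret almost_contact_B_space "phi M p" "xi M p" "eta M p" "met M p"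
      using almost_contact_B_space_at[OF acb] .
    let ?f = "phi M p" and ?g = "met M p" and ?\<eta> = "eta M p" and ?\<xi> = "xi M p"
    let ?\<theta> = "theta n M nabla p" and ?\<theta>s = "theta_star n M nabla p" and ?\<omega> = "omega M nabla p"
    define t1 t2 t3 where t: "t1 = vartheta n M nabla l 1 p" "t2 = vartheta n M nabla l 2 p"
      "t3 = vartheta n M nabla l 3 p"
    define S where "S x y z = ?g (?f y) (?f z) * t1 x + ?g y (?f z) * t2 x + ?\<eta> y * ?\<eta> z * t3 x" for x y z
    define Q where "Q X Y Z = ?g (D X Y p - nabla X Y p) (Z p)" for X Y Z
    note forms_lin = structural_forms_linear[OF acb, of nabla p]
    have "linear (vartheta n M nabla l k p)" for k
      by (rule linearI; simp add: vartheta_def Let_def lin_simps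
          forms_lin[THEN linear_add] forms_lin[THEN linear_cmul] algebra_simps)
    then have t_lin: "linear t1" "linear t2" "linear t3" unfolding t by blast+
    have phi_VF: "(\<lambda>q. phi M q (Y q)) \<in> ?VF" if "Y \<in> ?VF" for Y
      using acb that unfolding almost_contact_B_metric_def by blast
    have S_sym: "S x y z = S x z y" for x y z
    proof -
      have "?g y (?f z) = ?g z (?f y)" using g_f_left[of y z] g_sym[of "?f y" z] by simp
      then show ?thesis using g_sym[of "?f y" "?f z"] by (simp add: S_def)
    qed
    \<comment> \<open>The right-hand side depends on the values at \<open>p\<close> only, so \<open>Q\<close> turns out to be tensorial.\<close>
    have Q: "Q X Y Z = S (Z p) (X p) (Y p) - S (Y p) (X p) (Z p)"
      if "X \<in> ?VF" "Y \<in> ?VF" "Z \<in> ?VF" for X Y Z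
    proof (rule metric_difference_from_torsion[OF that, where S = "\<lambda>X Y Z. S (X p) (Y p) (Z p)"])
      fix X Y Z assume V: "X \<in> ?VF" "Y \<in> ?VF" "Z \<in> ?VF"
      have "torsion (atlas M) nabla X Y p = 0"
        using assms(3) V unfolding levi_civita_def by simp
      then have "torsion (atlas M) D X Y p = (D X Y p - nabla X Y p) - (D Y X p - nabla Y X p)"
        unfolding torsion_def by (simp add: algebra_simps)
      then show "Q X Y Z - Q Y X Z = S (X p) (Y p) (Z p) - S (Y p) (X p) (Z p)"
        using T[OF V, of p] unfolding Q_def S_def t by (simp add: lin_simps)
      have "dir_deriv (atlas M) X (\<lambda>q. met M q (Y q) (Z q)) p = ?g (C X Y p) (Z p) + ?g (Y p) (C X Z p)"
        if "metric_connection M C" for C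
        using that V unfolding metric_connection_def by simp
      from this[of D] this[of nabla]
      have "?g (D X Y p) (Z p) + ?g (Y p) (D X Z p) =
          ?g (nabla X Y p) (Z p) + ?g (Y p) (nabla X Z p)"
        using assms(3,5) unfolding levi_civita_def natural_connection_def by simp
      then show "Q X Y Z = - Q X Z Y"
        unfolding Q_def by (simp add: lin_simps g_sym[of "Y p"])
    qed (rule S_sym)
    \<comment> \<open>Both connections are metric and \<open>D\<close> commutes with \<open>\<phi>\<close>, so \<open>F(x,y,z) = Q(x,y,\<phi>z) - Q(x,\<phi>y,z)\<close>.\<close>
    have eq: "(S (?f z) x y - S y x (?f z)) - (S z x (?f y) - S (?f y) x z) =
      - 1 / (2 * real n) * (?g (?f x) (?f y) * ?\<theta> z + ?g x (?f y) * ?\<theta>s z - 2 * real n * ?\<eta> x * ?\<eta> y * ?\<omega> z +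
        ?g (?f x) (?f z) * ?\<theta> y + ?g x (?f z) * ?\<theta>s y - 2 * real n * ?\<eta> x * ?\<eta> z * ?\<omega> y)" for x y z
    proof -
      define X Y Z where "X = field_through (atlas M) p x" "Y = field_through (atlas M) p y"
        "Z = field_through (atlas M) p z"
      then have V: "X \<in> ?VF" "Y \<in> ?VF" "Z \<in> ?VF" and p: "X p = x" "Y p = y" "Z p = z"
        using field_through by auto
      have "D X (\<lambda>q. phi M q (Y q)) p = ?f (D X Y p)"
        using assms(5) V unfolding natural_connection_def by simp
      then have "F_tensor M nabla X Y Z p =
          Q X Y (\<lambda>q. phi M q (Z q)) - Q X (\<lambda>q. phi M q (Y q)) Z"
        unfolding F_tensor_def Q_def by (simp add: lin_simps g_f_left)
      moreover have "F_tensor M nabla X Y Z p = - 1 / (2 * real n) * (?g (?f x) (?f y) * ?\<theta> z +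
          ?g x (?f y) * ?\<theta>s z - 2 * real n * ?\<eta> x * ?\<eta> y * ?\<omega> z +
          ?g (?f x) (?f z) * ?\<theta> y + ?g x (?f z) * ?\<theta>s y - 2 * real n * ?\<eta> x * ?\<eta> z * ?\<omega> y)"
        using assms(4) V unfolding class_F1_F4_F5_F11_def Let_def p[symmetric] by simp
      ultimately show ?thesis
        using Q[OF V(1,2) phi_VF[OF V(3)]] Q[OF V(1) phi_VF[OF V(2)] V(3)] by (simp add: p)
    qed
    have "DIM('e) > 1" using acb assms(1) unfolding almost_contact_B_metric_def by simp
    then obtain h where h: "h \<noteq> 0" "?\<eta> h = 0"
      using exists_horizontal_vector[OF _ eta_linear eta_xi] by blast
    have N: "2 * real n \<noteq> 0" using assms(1) by simp
    note rel = natural_torsion_forms[OF t_lin forms_lin h N S_def eq]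
    note dual = metric_dual_eq[where \<alpha> = "theta n M nabla", OF acb forms_lin(1)]
      metric_dual_eq[where \<alpha> = "theta_star n M nabla", OF acb forms_lin(2)]
      metric_dual_eq[where \<alpha> = "omega M nabla", OF acb forms_lin(3)]
    \<comment> \<open>The terms of \<open>t1\<close> with \<open>l 3\<close> and \<open>l 4\<close> are multiples of \<open>\<eta>\<close>, whose coefficient \<open>rel\<close> determines;
      the other four become \<open>\<alpha>1, \<dots>, \<alpha>4\<close>.\<close>
    have t1: "t1 z = l 1 * ?\<theta> (?f (?f z)) + l 2 * ?\<theta>s (?f (?f z)) +
        (l 3 * ?\<theta> ?\<xi> + l 4 * ?\<theta>s ?\<xi>) * ?\<eta> z + l 5 * ?\<omega> z + l 6 * ?\<omega> (?f z)" for z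
      unfolding t vartheta_def Let_def by (simp add: algebra_simps numeral_2_eq_2)
    show ?thesis
      unfolding Let_def T[OF VF] pi2_def pi3_def pi4_def pi5_def t[symmetric]
      by (rule natural_torsion_formula[OF t_lin N rel[unfolded dual] t1[unfolded dual] refl])
  qed
  then show ?thesis by (intro exI[of _ "l 1"] exI[of _ "l 2"] exI[of _ "l 5"] exI[of _ "l 6"]) simp
qed

end
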